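(* Let $M_G$ be a mixed graph with $n$ vertices, let $\alpha\in[0,1]$, and let $\beta=a+ib$ with $a,b\in\mathbb{R}$, $|\beta|=1$ and $a\ge 0$. Let $\beta_1(A_\alpha^\beta)\ge\beta_2(A_\alpha^\beta)\ge\dots\ge\beta_n(A_\alpha^\beta)$ be the eigenvalues of the matrix $A_\alpha^\beta$ of $M_G$, and let $\rho(A_\alpha^\beta)$ be its spectral radius. Then $$\frac13\,\rho(A_\alpha^\beta)\le\beta_1(A_\alpha^\beta)\le\rho(A_\alpha^\beta).$$
   Context: A mixed graph $M_G=(V,E,A)$ consists of a vertex set $V=\{v_1,\dots,v_n\}$, a set $E$ of undirected edges and a set $A$ of directed edges (arcs). All mixed graphs are finite and simple (no loops, no multiple edges or arcs), so any two distinct vertices are joined by at most one undirected edge or arc. The underlying graph $G$ is the simple undirected graph obtained by forgetting the directions of the arcs. The degree $d_i$ of $v_i$ is its degree in $G$, and $D=\mathrm{diag}(d_1,\dots,d_n)$. The Hermitian adjacency matrix $H^\beta$ is the $n\times n$ matrix with $(v,u)$ entry equal to $\beta$ if there is an arc from $v$ to $u$, $\bar\beta$ if there is an arc from $u$ to $v$, $1$ if $\{v,u\}$ is an undirected edge, and $0$ otherwise. For $\alpha\in[0,1]$, $A_\alpha^\beta=\alpha D+(1-\alpha)H^\beta$, a Hermitian matrix, whose eigenvalues are real. The spectral radius $\rho$ of a matrix is the maximum of the absolute values of its eigenvalues. *)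

theory Defs
  imports Complex_Main "Jordan_Normal_Form.Char_Poly" "Jordan_Normal_Form.Spectral_Radius"
begin

text \<open>A pair \<open>(v, u) \<in> A\<close> is an arc from \<open>v\<close> to \<open>u\<close>.\<close>

locale mixed_graph =
  fixes V :: "'a set" and E :: "'a set set" and A :: "('a \<times> 'a) set"
  assumes finite_V: "finite V"
    and edges: "\<And>e. e \<in> E \<Longrightarrow> e \<subseteq> V \<and> card e = 2"
    and arcs_in_V: "A \<subseteq> V \<times> V"
    and no_loop: "(v, u) \<in> A \<Longrightarrow> v \<noteq> u"
    and no_opposite_arcs: "(v, u) \<in> A \<Longrightarrow> (u, v) \<notin> A"
    and no_edge_and_arc: "(v, u) \<in> A \<Longrightarrow> {v, u} \<notin> E"

definition underlying_edges :: "'a set set \<Rightarrow> ('a \<times> 'a) set \<Rightarrow> 'a set set" where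
  "underlying_edges E A = E \<union> {{v, u} | v u. (v, u) \<in> A}"

definition degree_of :: "'a set \<Rightarrow> 'a set set \<Rightarrow> ('a \<times> 'a) set \<Rightarrow> 'a \<Rightarrow> nat" where
  "degree_of V E A v = card {u \<in> V. {v, u} \<in> underlying_edges E A}"

definition hermitian_entry :: "'a set set \<Rightarrow> ('a \<times> 'a) set \<Rightarrow> complex \<Rightarrow> 'a \<Rightarrow> 'a \<Rightarrow> complex" where
  "hermitian_entry E A \<beta> v u =
     (if (v, u) \<in> A then \<beta>
      else if (u, v) \<in> A then cnj \<beta>
      else if {v, u} \<in> E then 1
      else 0)"

text \<open>In the matrices below, \<open>vs\<close> lists the vertices \<open>v\<^sub>1, \<dots>, v\<^sub>n\<close>; the vertex \<open>v\<^sub>i\<close> is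
  \<open>vs ! (i - 1)\<close>, since rows and columns are counted from 0.\<close>

definition degree_matrix :: "'a list \<Rightarrow> 'a set set \<Rightarrow> ('a \<times> 'a) set \<Rightarrow> complex mat" where
  "degree_matrix vs E A =
     mat (length vs) (length vs)
       (\<lambda>(i, j). if i = j then of_nat (degree_of (set vs) E A (vs ! i)) else 0)"

definition hermitian_adjacency_matrix ::
    "'a list \<Rightarrow> 'a set set \<Rightarrow> ('a \<times> 'a) set \<Rightarrow> complex \<Rightarrow> complex mat" where
  "hermitian_adjacency_matrix vs E A \<beta> =
     mat (length vs) (length vs) (\<lambda>(i, j). hermitian_entry E A \<beta> (vs ! i) (vs ! j))"

definition A_alpha_beta ::
    "'a list \<Rightarrow> 'a set set \<Rightarrow> ('a \<times> 'a) set \<Rightarrow> real \<Rightarrow> complex \<Rightarrow> complex mat" where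
  "A_alpha_beta vs E A \<alpha> \<beta> =
     complex_of_real \<alpha> \<cdot>\<^sub>m degree_matrix vs E A
     + complex_of_real (1 - \<alpha>) \<cdot>\<^sub>m hermitian_adjacency_matrix vs E A \<beta>"

text \<open>The values \<open>ev 1 \<ge> \<dots> \<ge> ev n\<close> are all the eigenvalues of the \<open>n \<times> n\<close> matrix \<open>M\<close>,
  repeated according to multiplicity as roots of the characteristic polynomial.\<close>

definition ordered_eigenvalues :: "complex mat \<Rightarrow> (nat \<Rightarrow> real) \<Rightarrow> bool" where
  "ordered_eigenvalues M ev \<longleftrightarrow>
     antimono_on {1..dim_row M} ev \<and>
     char_poly M = (\<Prod>k=1..dim_row M. [:- complex_of_real (ev k), 1:])"

text \<open>Such a sequence exists for the matrices considered here.\<close>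

lemma hermitian_eigenvalue_real:
  fixes M :: "complex mat"
  assumes M: "M \<in> carrier_mat n n"
    and herm: "\<And>i j. i < n \<Longrightarrow> j < n \<Longrightarrow> M $$ (i, j) = cnj (M $$ (j, i))"
    and ev: "eigenvalue M k"
  shows "k \<in> \<real>"
proof -
  obtain v where v: "v \<in> carrier_vec n" "v \<noteq> 0\<^sub>v n" "M *\<^sub>v v = k \<cdot>\<^sub>v v"
    using ev M unfolding eigenvalue_def eigenvector_def by auto
  define s where "s = (\<Sum>i<n. v $ i * cnj (v $ i))"
  define q where "q = (\<Sum>i<n. \<Sum>j<n. M $$ (i, j) * v $ j * cnj (v $ i))"
  have row: "(\<Sum>j<n. M $$ (i, j) * v $ j) = k * v $ i" if "i < n" for i
  proof -
    have "(M *\<^sub>v v) $ i = (\<Sum>j<n. M $$ (i, j) * v $ j)"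
      using that M v(1) by (auto simp: scalar_prod_def atLeast0LessThan intro!: sum.cong)
    then show ?thesis using v that by auto
  qed
  have q1: "q = k * s"
    unfolding q_def s_def sum_distrib_left
    by (rule sum.cong) (auto simp: sum_distrib_right[symmetric] row)
  have "cnj q = (\<Sum>i<n. \<Sum>j<n. M $$ (j, i) * cnj (v $ j) * v $ i)"
    unfolding q_def cnj_sum by (intro sum.cong refl) (simp add: herm[symmetric])
  also have "\<dots> = q"
    unfolding q_def by (subst sum.swap) (intro sum.cong refl, simp)
  finally have q2: "cnj q = q" .
  have s: "s = of_real (\<Sum>i<n. (cmod (v $ i))\<^sup>2)"
    unfolding s_def of_real_sum by (intro sum.cong refl) (metis complex_norm_square)
  have "\<exists>i<n. v $ i \<noteq> 0"
    using v(1,2) by (metis eq_vecI carrier_vecD index_zero_vec)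
  then have "(\<Sum>i<n. (cmod (v $ i))\<^sup>2) > 0"
    by (auto intro!: sum_pos2)
  then have "s \<noteq> 0" unfolding s of_real_eq_0_iff by linarith
  moreover have "cnj s = s" unfolding s by simp
  ultimately have "cnj k = k" using q1 q2 by (metis complex_cnj_mult mult_right_cancel)
  then show ?thesis by (simp add: Reals_cnj_iff)
qed

lemma ordered_eigenvalues_exist:
  assumes "mixed_graph V E A" and "distinct vs"
  shows "\<exists>ev. ordered_eigenvalues (A_alpha_beta vs E A \<alpha> \<beta>) ev"
proof -
  interpret mixed_graph V E A by fact
  define n where "n = length vs"
  define M where "M = A_alpha_beta vs E A \<alpha> \<beta>"
  have M: "M \<in> carrier_mat n n"
    unfolding M_def A_alpha_beta_def degree_matrix_def hermitian_adjacency_matrix_def n_def by auto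
  have herm: "M $$ (i, j) = cnj (M $$ (j, i))" if "i < n" "j < n" for i j
    using that no_opposite_arcs no_loop
    unfolding M_def A_alpha_beta_def degree_matrix_def hermitian_adjacency_matrix_def n_def
      hermitian_entry_def
    by (auto simp: insert_commute)
  obtain as where as: "char_poly M = (\<Prod>a\<leftarrow>as. [:- a, 1:])" "length as = n"
    using char_poly_factorized[OF M] by auto
  have real: "a \<in> \<real>" if "a \<in> set as" for a
  proof (rule hermitian_eigenvalue_real[OF M herm])
    show "eigenvalue M a"
      unfolding eigenvalue_root_char_poly[OF M] as(1) using that
      by (auto simp: poly_prod_list prod_list_zero_iff)
  qed
  define bs where "bs = rev (sort (map Re as))"
  define ev where "ev k = bs ! (k - 1)" for k
  have len: "length bs = n" using as(2) by (simp add: bs_def)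
  have "map (complex_of_real \<circ> Re) as = as"
    by (rule map_idI) (use real in \<open>auto simp: of_real_Re\<close>)
  moreover have "mset (map complex_of_real bs) = mset (map (complex_of_real \<circ> Re) as)"
    unfolding bs_def by (simp add: multiset.map_comp)
  ultimately have "mset (map complex_of_real bs) = mset as" by simp
  then have "mset (map (\<lambda>a. [:- a, 1:]) as) = mset (map (\<lambda>a. [:- a, 1:]) (map complex_of_real bs))"
    by (metis mset_map)
  then have "char_poly M = (\<Prod>b\<leftarrow>bs. [:- complex_of_real b, 1:])"
    unfolding as(1) by (metis (no_types, lifting) map_map comp_def map_eq_conv prod_mset_prod_list)
  also have "\<dots> = (\<Prod>k<n. [:- complex_of_real (bs ! k), 1:])"
    by (simp add: prod.list_conv_set_nth len atLeast0LessThan)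
  also have "\<dots> = (\<Prod>k=1..n. [:- complex_of_real (ev k), 1:])"
    by (rule prod.reindex_bij_witness[where i = "\<lambda>k. k - 1" and j = Suc]) (auto simp: ev_def)
  finally have cp: "char_poly M = (\<Prod>k=1..n. [:- complex_of_real (ev k), 1:])" .
  have "antimono_on {1..n} ev"
  proof (rule monotone_onI)
    fix i j assume ij: "i \<in> {1..n}" "j \<in> {1..n}" "i \<le> j"
    then show "ev j \<le> ev i"
      using sorted_rev_nth_mono[of bs "i - 1" "j - 1"] len
      by (auto simp: ev_def bs_def)
  qed
  then have "ordered_eigenvalues M ev"
    unfolding ordered_eigenvalues_def using cp M by auto
  then show ?thesis unfolding M_def by blast
qed

end

theory Submission
  imports Defs
begin

text \<open>
  The bound holds for every Hermitian matrix \<open>M\<close> all of whose entries have nonnegative real part,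
  and \<open>A_alpha_beta\<close> is such a matrix because its diagonal is \<open>\<alpha>\<close> times the degrees and its other
  entries are \<open>1 - \<alpha>\<close> times \<open>\<beta>\<close>, its conjugate, \<open>1\<close> or \<open>0\<close>.

  Let \<open>q\<close> be the quadratic form of \<open>M\<close> and \<open>x\<close> an eigenvector of a negative eigenvalue \<open>r\<close>. The three
  vectors \<open>x\<close>, its entrywise conjugate \<open>x'\<close> and its entrywise modulus \<open>\<bar>x\<bar>\<close> have the same norm, and
  \<open>q(x) + q(x') + 2 q(\<bar>x\<bar>) \<ge> 0\<close> (lemma \<open>quad_form_three_vectors\<close>). The first term is \<open>r\<close> times the
  squared norm of \<open>x\<close>, and by the Rayleigh principle the other two are together at most \<open>3\<close> times
  the largest eigenvalue times that squared norm. Hence \<open>-r\<close> is at most three times the largest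
  eigenvalue.

  The Rayleigh principle (\<open>rayleigh_bound_attained_by_eigenvalue\<close>) is proved here without
  diagonalizing \<open>M\<close>. Let \<open>\<mu>\<close> be the supremum of the Rayleigh quotient, so that \<open>Q = M - \<mu> I\<close> is
  negative semidefinite. Its form then controls the image: the squared norm of \<open>Q y\<close> is at most a
  constant times \<open>-\<langle>Q y, y\<rangle>\<close> (\<open>neg_semidef_image_bound\<close>). If \<open>Q\<close> were invertible, \<open>Q y\<close> would in turn
  control \<open>y\<close>, and \<open>\<mu>\<close> could be lowered. So \<open>\<mu>\<close> is an eigenvalue.
\<close>

section \<open>Quadratic forms of complex matrices\<close>

definition norm_sq :: "complex vec \<Rightarrow> real" where
  "norm_sq x = (\<Sum>i<dim_vec x. (cmod (x $ i))\<^sup>2)"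

definition quad_form :: "complex mat \<Rightarrow> complex vec \<Rightarrow> real" where
  "quad_form M x = Re ((M *\<^sub>v x) \<bullet>c x)"

definition hermitian_mat :: "complex mat \<Rightarrow> bool" where
  "hermitian_mat M \<longleftrightarrow>
     square_mat M \<and> (\<forall>i<dim_row M. \<forall>j<dim_row M. M $$ (i, j) = cnj (M $$ (j, i)))"

lemma norm_sq_nonneg: "norm_sq x \<ge> 0"
  unfolding norm_sq_def by (simp add: sum_nonneg)

lemma norm_sq_pos:
  assumes "x \<in> carrier_vec n" "x \<noteq> 0\<^sub>v n"
  shows "norm_sq x > 0"
proof -
  have "\<exists>i<n. x $ i \<noteq> 0"
    using assms by (metis eq_vecI carrier_vecD index_zero_vec)
  then show ?thesis
    using assms(1) unfolding norm_sq_def by (auto intro!: sum_pos2)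
qed

lemma norm_sq_eq_scalar_prod: "x \<bullet>c x = complex_of_real (norm_sq x)"
  unfolding norm_sq_def scalar_prod_def of_real_sum
  by (simp add: atLeast0LessThan complex_norm_square del: of_real_power)

lemma mult_mat_vec_component:
  assumes "M \<in> carrier_mat n n" "x \<in> carrier_vec n" "i < n"
  shows "(M *\<^sub>v x) $ i = (\<Sum>j<n. M $$ (i, j) * x $ j)"
  using assms by (auto simp: scalar_prod_def atLeast0LessThan intro!: sum.cong)

lemma sesquilinear_form_sum:
  assumes "M \<in> carrier_mat n n" "x \<in> carrier_vec n" "y \<in> carrier_vec n"
  shows "(M *\<^sub>v x) \<bullet>c y = (\<Sum>i<n. \<Sum>j<n. M $$ (i, j) * x $ j * cnj (y $ i))"
proof -
  have "(M *\<^sub>v x) \<bullet>c y = (\<Sum>i<n. (M *\<^sub>v x) $ i * cnj (y $ i))"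
    using assms by (auto simp: scalar_prod_def atLeast0LessThan intro!: sum.cong)
  then show ?thesis
    using assms by (simp add: mult_mat_vec_component sum_distrib_right del: index_mult_mat_vec)
qed

lemma quad_form_sum:
  assumes "M \<in> carrier_mat n n" "x \<in> carrier_vec n"
  shows "quad_form M x = (\<Sum>i<n. \<Sum>j<n. Re (M $$ (i, j) * (x $ j * cnj (x $ i))))"
  unfolding quad_form_def sesquilinear_form_sum[OF assms assms(2)]
  by (simp only: Re_sum mult.assoc)

lemma hermitian_mat_self_adjoint:
  assumes "hermitian_mat M" and M: "M \<in> carrier_mat n n"
    and x: "x \<in> carrier_vec n" and y: "y \<in> carrier_vec n"
  shows "(M *\<^sub>v x) \<bullet>c y = cnj ((M *\<^sub>v y) \<bullet>c x)"
proof -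
  have "(M *\<^sub>v x) \<bullet>c y = (\<Sum>i<n. \<Sum>j<n. cnj (M $$ (j, i)) * x $ j * cnj (y $ i))"
    unfolding sesquilinear_form_sum[OF M x y]
  proof (intro sum.cong refl)
    fix i j assume "i \<in> {..<n}" "j \<in> {..<n}"
    then have "M $$ (i, j) = cnj (M $$ (j, i))"
      using assms(1) M unfolding hermitian_mat_def by blast
    then show "M $$ (i, j) * x $ j * cnj (y $ i) = cnj (M $$ (j, i)) * x $ j * cnj (y $ i)"
      by (simp only:)
  qed
  also have "\<dots> = (\<Sum>j<n. \<Sum>i<n. cnj (M $$ (j, i)) * x $ j * cnj (y $ i))"
    by (rule sum.swap)
  also have "\<dots> = cnj ((M *\<^sub>v y) \<bullet>c x)"
    unfolding sesquilinear_form_sum[OF M y x] cnj_sum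
    by (intro sum.cong refl) (simp add: mult_ac)
  finally show ?thesis .
qed

lemma norm_sq_mult_mat_vec_bound:
  assumes A: "A \<in> carrier_mat n n"
  obtains K where "K > 0" "\<And>x. x \<in> carrier_vec n \<Longrightarrow> norm_sq (A *\<^sub>v x) \<le> K * norm_sq x"
proof
  define R where "R i = (\<Sum>j<n. cmod (A $$ (i, j)))" for i
  define K where "K = (\<Sum>i<n. (R i)\<^sup>2) + 1"
  show "K > 0" unfolding K_def by (simp add: sum_nonneg add_nonneg_pos)
  fix x :: "complex vec" assume x: "x \<in> carrier_vec n"
  have comp: "cmod (x $ j) \<le> sqrt (norm_sq x)" if "j < n" for j
    using that x member_le_sum[of j "{..<n}" "\<lambda>i. (cmod (x $ i))\<^sup>2"]
    by (auto simp: norm_sq_def intro!: real_le_rsqrt)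
  have row: "(cmod ((A *\<^sub>v x) $ i))\<^sup>2 \<le> (R i)\<^sup>2 * norm_sq x" if i: "i < n" for i
  proof -
    have "cmod ((A *\<^sub>v x) $ i) \<le> (\<Sum>j<n. cmod (A $$ (i, j) * x $ j))"
      unfolding mult_mat_vec_component[OF A x i] by (rule norm_sum)
    also have "\<dots> \<le> (\<Sum>j<n. cmod (A $$ (i, j)) * sqrt (norm_sq x))"
      by (intro sum_mono) (simp add: norm_mult mult_left_mono comp)
    also have "\<dots> = R i * sqrt (norm_sq x)"
      by (simp add: R_def sum_distrib_right)
    finally have "(cmod ((A *\<^sub>v x) $ i))\<^sup>2 \<le> (R i * sqrt (norm_sq x))\<^sup>2"
      by (rule power_mono) simp
    then show ?thesis by (simp add: power_mult_distrib norm_sq_nonneg)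
  qed
  have "norm_sq (A *\<^sub>v x) \<le> (\<Sum>i<n. (R i)\<^sup>2) * norm_sq x"
    unfolding norm_sq_def[of "A *\<^sub>v x"] sum_distrib_right
    using A row by (auto intro!: sum_mono simp del: index_mult_mat_vec)
  also have "\<dots> \<le> K * norm_sq x"
    unfolding K_def by (simp add: norm_sq_nonneg distrib_right)
  finally show "norm_sq (A *\<^sub>v x) \<le> K * norm_sq x" .
qed

lemma quad_form_bound:
  assumes A: "A \<in> carrier_mat n n"
  obtains K where "K > 0" "\<And>x. x \<in> carrier_vec n \<Longrightarrow> \<bar>quad_form A x\<bar> \<le> K * norm_sq x"
proof -
  obtain L where L: "L > 0" "\<And>x. x \<in> carrier_vec n \<Longrightarrow> norm_sq (A *\<^sub>v x) \<le> L * norm_sq x"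
    using norm_sq_mult_mat_vec_bound[OF A] by blast
  have "\<bar>quad_form A x\<bar> \<le> (L + 1) * norm_sq x" if x: "x \<in> carrier_vec n" for x
  proof -
    have amgm: "\<bar>Re (u * cnj v)\<bar> \<le> (cmod u)\<^sup>2 + (cmod v)\<^sup>2" for u v
    proof -
      have "\<bar>Re (u * cnj v)\<bar> \<le> cmod u * cmod v"
        by (metis abs_Re_le_cmod norm_mult complex_mod_cnj)
      also have "\<dots> \<le> (cmod u)\<^sup>2 + (cmod v)\<^sup>2"
        using sum_squares_bound[of "cmod u" "cmod v"]
          mult_nonneg_nonneg[OF norm_ge_zero[of u] norm_ge_zero[of v]]
        by linarith
      finally show ?thesis .
    qed
    have "quad_form A x = (\<Sum>i<n. Re ((A *\<^sub>v x) $ i * cnj (x $ i)))"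
      using x A unfolding quad_form_def Re_sum[symmetric]
      by (auto simp: scalar_prod_def[of "A *\<^sub>v x"] atLeast0LessThan simp del: index_mult_mat_vec
          intro!: sum.cong)
    then have "\<bar>quad_form A x\<bar> \<le> (\<Sum>i<n. \<bar>Re ((A *\<^sub>v x) $ i * cnj (x $ i))\<bar>)"
      by (simp only: sum_abs)
    also have "\<dots> \<le> (\<Sum>i<n. (cmod ((A *\<^sub>v x) $ i))\<^sup>2 + (cmod (x $ i))\<^sup>2)"
      by (intro sum_mono amgm)
    also have "\<dots> = norm_sq (A *\<^sub>v x) + norm_sq x"
      using x A by (simp add: norm_sq_def sum.distrib del: index_mult_mat_vec)
    finally show ?thesis using L(2)[OF x] by (simp add: distrib_right)
  qed
  with L(1) show ?thesis using that[of "L + 1"] by simp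
qed

section \<open>The largest value of the Rayleigh quotient is an eigenvalue\<close>

text \<open>
  Going from \<open>y\<close> a small step \<open>t > 0\<close> in the direction \<open>w = Q y\<close> changes the form by
  \<open>2 t \<parallel>w\<parallel>\<^sup>2 + t\<^sup>2 \<langle>Q w, w\<rangle>\<close>. Since the form stays nonpositive, the gain cannot exceed \<open>-\<langle>Q y, y\<rangle>\<close>.
\<close>

lemma neg_semidef_image_bound:
  assumes herm: "hermitian_mat Q" and Q: "Q \<in> carrier_mat n n"
    and neg: "\<And>x. x \<in> carrier_vec n \<Longrightarrow> quad_form Q x \<le> 0"
  obtains K where "K > 0" "\<And>y. y \<in> carrier_vec n \<Longrightarrow> norm_sq (Q *\<^sub>v y) \<le> - K * quad_form Q y"
proof -
  obtain K where K: "K > 0" "\<And>x. x \<in> carrier_vec n \<Longrightarrow> \<bar>quad_form Q x\<bar> \<le> K * norm_sq x"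
    using quad_form_bound[OF Q] by blast
  have "norm_sq (Q *\<^sub>v y) \<le> - K * quad_form Q y" if y: "y \<in> carrier_vec n" for y
  proof -
    define w where "w = Q *\<^sub>v y"
    \<comment> \<open>With \<open>\<langle>Q w, w\<rangle> \<ge> - K \<parallel>w\<parallel>\<^sup>2\<close> the guaranteed gain is \<open>(2 t - K t\<^sup>2) \<parallel>w\<parallel>\<^sup>2\<close>, largest at \<open>t = 1 / K\<close>.\<close>
    define t where "t = 1 / K"
    define z where "z = y + complex_of_real t \<cdot>\<^sub>v w"
    have w: "w \<in> carrier_vec n" using Q y by (simp add: w_def)
    have z: "z \<in> carrier_vec n" using y w by (simp add: z_def)
    have Qw: "Q *\<^sub>v w \<in> carrier_vec n" using Q w by simp
    have "Q *\<^sub>v z = w + complex_of_real t \<cdot>\<^sub>v (Q *\<^sub>v w)"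
      unfolding z_def using Q y w
      by (simp add: mult_add_distrib_mat_vec mult_mat_vec flip: w_def)
    moreover have "conjugate z = conjugate y + complex_of_real t \<cdot>\<^sub>v conjugate w"
      unfolding z_def using y w
      by (simp add: conjugate_add_vec[of _ n] conjugate_smult_vec)
    ultimately have "(Q *\<^sub>v z) \<bullet>c z = w \<bullet>c y + t * (w \<bullet>c w) + t * ((Q *\<^sub>v w) \<bullet>c y)
        + t\<^sup>2 * ((Q *\<^sub>v w) \<bullet>c w)"
      using y w Qw
      by (simp add: add_scalar_prod_distrib[of _ n] scalar_prod_add_distrib[of _ n]
          smult_scalar_prod_distrib[of _ n] scalar_prod_smult_distrib[of _ n]
          power2_eq_square algebra_simps)
    moreover have "(Q *\<^sub>v w) \<bullet>c y = cnj (w \<bullet>c w)"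
      using hermitian_mat_self_adjoint[OF herm Q w y] by (simp add: w_def)
    ultimately have "quad_form Q z = quad_form Q y + 2 * t * norm_sq w + t\<^sup>2 * quad_form Q w"
      by (simp add: quad_form_def norm_sq_eq_scalar_prod flip: w_def of_real_power)
    moreover have "t\<^sup>2 * quad_form Q w \<ge> t\<^sup>2 * (- K * norm_sq w)"
      using K(2)[OF w] by (intro mult_left_mono) auto
    moreover have "t\<^sup>2 * (- K * norm_sq w) = - t * norm_sq w"
      using K(1) by (simp add: t_def power2_eq_square)
    ultimately have "t * norm_sq w \<le> - quad_form Q y"
      using neg[OF z] by linarith
    then show ?thesis
      using K(1) by (simp add: t_def w_def field_simps)
  qed
  with K(1) show ?thesis using that by blast
qed

lemma quad_form_char_matrix:
  assumes M: "M \<in> carrier_mat n n" and x: "x \<in> carrier_vec n"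
  shows "quad_form (char_matrix M (complex_of_real t)) x = quad_form M x - t * norm_sq x"
proof -
  have "char_matrix M (complex_of_real t) *\<^sub>v x = M *\<^sub>v x + complex_of_real (- t) \<cdot>\<^sub>v x"
    using M x unfolding char_matrix_def
    by (auto simp: add_mult_distrib_mat_vec[of _ n n] add_scalar_prod_distrib[of _ n]
        intro!: eq_vecI)
  then show ?thesis
    using M x
    by (simp add: quad_form_def add_scalar_prod_distrib[of _ n] norm_sq_eq_scalar_prod
        smult_scalar_prod_distrib[of _ n])
qed

lemma det_nonzero_left_inverse:
  fixes A :: "'b :: field mat"
  assumes "A \<in> carrier_mat n n" "det A \<noteq> 0"
  obtains B where "B \<in> carrier_mat n n" "B * A = 1\<^sub>m n"
  using det_non_zero_imp_unit[OF assms, of "()"] by (auto simp: Units_def ring_mat_def)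

text \<open>
  The number \<open>\<mu>\<close> is the least upper bound of the Rayleigh quotient. Were it not an eigenvalue, the
  bound could be improved by \<open>1 / (L C)\<close>, where \<open>L\<close> bounds the inverse of \<open>M - \<mu> I\<close> and \<open>C\<close> comes from
  the preceding control of the image by the form.
\<close>

theorem rayleigh_bound_attained_by_eigenvalue:
  assumes herm: "hermitian_mat M" and M: "M \<in> carrier_mat n n" and n: "n > 0"
  obtains \<mu> where "eigenvalue M (complex_of_real \<mu>)"
    "\<And>x. x \<in> carrier_vec n \<Longrightarrow> quad_form M x \<le> \<mu> * norm_sq x"
proof
  define S where "S = {t. \<forall>x\<in>carrier_vec n. quad_form M x \<le> t * norm_sq x}"
  define \<mu> where "\<mu> = Inf S"
  obtain K where K: "\<And>x. x \<in> carrier_vec n \<Longrightarrow> \<bar>quad_form M x\<bar> \<le> K * norm_sq x"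
    using quad_form_bound[OF M] by blast
  have "quad_form M x \<le> K * norm_sq x" if "x \<in> carrier_vec n" for x
    using K[OF that] by linarith
  then have S_ne: "S \<noteq> {}" unfolding S_def by blast
  have e: "unit_vec n 0 \<in> carrier_vec n" "norm_sq (unit_vec n 0) > 0"
    using n by (auto intro!: norm_sq_pos[of _ n] dest: arg_cong[of _ _ "\<lambda>v. v $ 0"])
  have lower: "quad_form M x / norm_sq x \<le> t"
    if "t \<in> S" "x \<in> carrier_vec n" "norm_sq x > 0" for x t
    using that by (auto simp: S_def divide_le_eq)
  have S_bdd: "bdd_below S"
    using lower[OF _ e] by (rule bdd_belowI)
  show \<mu>_bound: "quad_form M x \<le> \<mu> * norm_sq x" if x: "x \<in> carrier_vec n" for x
  proof (cases "norm_sq x > 0")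
    case True
    have "quad_form M x / norm_sq x \<le> \<mu>"
      unfolding \<mu>_def using S_ne lower x True by (intro cInf_greatest) auto
    then show ?thesis using True by (simp add: divide_le_eq)
  next
    case False
    then have "norm_sq x = 0" using norm_sq_nonneg[of x] by linarith
    then show ?thesis using K[OF x] by simp
  qed
  show "eigenvalue M (complex_of_real \<mu>)"
  proof (rule ccontr)
    define Q where "Q = char_matrix M (complex_of_real \<mu>)"
    assume "\<not> eigenvalue M (complex_of_real \<mu>)"
    then have det: "det Q \<noteq> 0" by (simp add: Q_def eigenvalue_det[OF M])
    have Q: "Q \<in> carrier_mat n n" using M by (simp add: Q_def)
    obtain B where B: "B \<in> carrier_mat n n" "B * Q = 1\<^sub>m n"
      using det_nonzero_left_inverse[OF Q det] .
    obtain L where L: "L > 0" "\<And>x. x \<in> carrier_vec n \<Longrightarrow> norm_sq (B *\<^sub>v x) \<le> L * norm_sq x"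
      using norm_sq_mult_mat_vec_bound[OF B(1)] by blast
    have Q_herm: "hermitian_mat Q"
    proof -
      have "Q $$ (i, j) = cnj (Q $$ (j, i))" if ij: "i < n" "j < n" for i j
      proof -
        have "M $$ (i, j) = cnj (M $$ (j, i))"
          using herm M ij unfolding hermitian_mat_def by blast
        then show ?thesis
          using M ij by (simp add: Q_def char_matrix_def)
      qed
      then have "\<forall>i<dim_row Q. \<forall>j<dim_row Q. Q $$ (i, j) = cnj (Q $$ (j, i))"
        using Q by blast
      moreover have "square_mat Q" using Q by simp
      ultimately show ?thesis unfolding hermitian_mat_def by blast
    qed
    have Q_neg: "quad_form Q x \<le> 0" if "x \<in> carrier_vec n" for x
      using \<mu>_bound[OF that] by (simp add: Q_def quad_form_char_matrix[OF M that])
    obtain C where C: "C > 0"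
      "\<And>y. y \<in> carrier_vec n \<Longrightarrow> norm_sq (Q *\<^sub>v y) \<le> - C * quad_form Q y"
      using neg_semidef_image_bound[OF Q_herm Q Q_neg] by blast
    have "quad_form M x \<le> (\<mu> - 1 / (L * C)) * norm_sq x" if x: "x \<in> carrier_vec n" for x
    proof -
      have "x = B *\<^sub>v (Q *\<^sub>v x)"
        using B Q x by (metis assoc_mult_mat_vec one_mult_mat_vec)
      then have "norm_sq x \<le> L * norm_sq (Q *\<^sub>v x)"
        using L(2)[of "Q *\<^sub>v x"] Q x by simp
      also have "\<dots> \<le> L * (- C * quad_form Q x)"
        using L(1) C(2)[OF x] by (intro mult_left_mono) auto
      also have "\<dots> = (L * C) * (\<mu> * norm_sq x - quad_form M x)"
        by (simp add: Q_def quad_form_char_matrix[OF M x] algebra_simps)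
      finally have "norm_sq x / (L * C) \<le> \<mu> * norm_sq x - quad_form M x"
        using L(1) C(1) by (simp add: divide_le_eq mult.commute)
      then show ?thesis by (simp add: left_diff_distrib)
    qed
    then have "\<mu> - 1 / (L * C) \<in> S" by (simp add: S_def)
    then have "\<mu> \<le> \<mu> - 1 / (L * C)"
      unfolding \<mu>_def using S_bdd by (rule cInf_lower)
    moreover have "1 / (L * C) > 0" using L(1) C(1) by simp
    ultimately show False by linarith
  qed
qed

section \<open>Matrices whose entries have nonnegative real part\<close>

text \<open>
  The inequality holds entry by entry: if \<open>m\<close> has nonnegative real part, then
  \<open>Re (m z) + Re (m (cnj z)) + 2 Re (m \<bar>z\<bar>) = 2 Re m (Re z + \<bar>z\<bar>) \<ge> 0\<close>, applied to an entry \<open>m\<close> of \<open>M\<close>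
  and the product \<open>z\<close> of one component of \<open>x\<close> with the conjugate of another. The imaginary part of
  \<open>m\<close>, which has no sign, cancels between \<open>x\<close> and its conjugate; the modulus vector compensates the
  real part.
\<close>

lemma quad_form_three_vectors:
  assumes M: "M \<in> carrier_mat n n" and x: "x \<in> carrier_vec n"
    and Re_nonneg: "\<And>i j. i < n \<Longrightarrow> j < n \<Longrightarrow> Re (M $$ (i, j)) \<ge> 0"
  shows "0 \<le> quad_form M x + quad_form M (conjugate x)
    + 2 * quad_form M (vec n (\<lambda>i. complex_of_real (cmod (x $ i))))"
proof -
  define y where "y = vec n (\<lambda>i. complex_of_real (cmod (x $ i)))"
  have y: "y \<in> carrier_vec n" by (simp add: y_def)
  have entry: "0 \<le> Re (m * (u * cnj v)) + Re (m * (cnj u * v))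
      + 2 * Re (m * (cmod u * cmod v))" if "Re m \<ge> 0" for m u v
  proof -
    define z where "z = u * cnj v"
    have "Re (m * z) + Re (m * cnj z) + 2 * Re (m * cmod z) = 2 * Re m * (Re z + cmod z)"
      by (simp add: algebra_simps)
    moreover have "Re z + cmod z \<ge> 0"
      using abs_Re_le_cmod[of z] by linarith
    ultimately show ?thesis
      using that by (simp add: z_def norm_mult)
  qed
  have "quad_form M x + quad_form M (conjugate x) + 2 * quad_form M y
    = (\<Sum>i<n. \<Sum>j<n. Re (M $$ (i, j) * (x $ j * cnj (x $ i)))
        + Re (M $$ (i, j) * (cnj (x $ j) * x $ i))
        + 2 * Re (M $$ (i, j) * (cmod (x $ j) * cmod (x $ i))))"
    using x
    by (simp add: quad_form_sum[OF M] y y_def sum.distrib sum_distrib_left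
        del: times_complex.sel)
  also have "\<dots> \<ge> 0"
    using Re_nonneg by (intro sum_nonneg entry) auto
  finally show ?thesis by (simp add: y_def)
qed

text \<open>
  The factor \<open>3\<close> is the total weight with which the conjugate (once) and the modulus vector (twice)
  of an eigenvector enter the preceding inequality.
\<close>

theorem eigenvalue_ge_minus_three_times_bound:
  assumes M: "M \<in> carrier_mat n n"
    and Re_nonneg: "\<And>i j. i < n \<Longrightarrow> j < n \<Longrightarrow> Re (M $$ (i, j)) \<ge> 0"
    and bound: "\<And>x. x \<in> carrier_vec n \<Longrightarrow> quad_form M x \<le> \<mu> * norm_sq x"
    and ev: "eigenvalue M (complex_of_real r)"
  shows "- r \<le> 3 * \<mu>"
proof -
  obtain x where x: "x \<in> carrier_vec n" "x \<noteq> 0\<^sub>v n" "M *\<^sub>v x = complex_of_real r \<cdot>\<^sub>v x"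
    using ev M unfolding eigenvalue_def eigenvector_def by auto
  define y where "y = vec n (\<lambda>i. complex_of_real (cmod (x $ i)))"
  have y: "y \<in> carrier_vec n" by (simp add: y_def)
  have x': "conjugate x \<in> carrier_vec n" using x by simp
  have pos: "norm_sq x > 0" using x norm_sq_pos by blast
  have "quad_form M x = r * norm_sq x"
    using x(1) by (simp add: quad_form_def x(3) norm_sq_eq_scalar_prod)
  moreover have "norm_sq (conjugate x) = norm_sq x" "norm_sq y = norm_sq x"
    using x(1) by (auto simp: norm_sq_def y_def)
  ultimately have "(- r) * norm_sq x \<le> (3 * \<mu>) * norm_sq x"
    using quad_form_three_vectors[OF M x(1) Re_nonneg, folded y_def] bound[OF x'] bound[OF y]
    by simp
  then show ?thesis using pos by (rule mult_right_le_imp_le)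
qed

section \<open>The spectral radius of a mixed graph\<close>

lemma A_alpha_beta_carrier: "A_alpha_beta vs E A \<alpha> \<beta> \<in> carrier_mat (length vs) (length vs)"
  unfolding A_alpha_beta_def degree_matrix_def hermitian_adjacency_matrix_def by auto

lemma A_alpha_beta_hermitian:
  assumes "mixed_graph V E A"
  shows "hermitian_mat (A_alpha_beta vs E A \<alpha> \<beta>)"
proof -
  interpret mixed_graph V E A by fact
  show ?thesis
    using no_opposite_arcs no_loop
    unfolding hermitian_mat_def A_alpha_beta_def degree_matrix_def
      hermitian_adjacency_matrix_def hermitian_entry_def
    by (auto simp: insert_commute)
qed

lemma A_alpha_beta_Re_nonneg:
  assumes "0 \<le> \<alpha>" "\<alpha> \<le> 1" "Re \<beta> \<ge> 0" "i < length vs" "j < length vs"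
  shows "Re (A_alpha_beta vs E A \<alpha> \<beta> $$ (i, j)) \<ge> 0"
  using assms unfolding A_alpha_beta_def degree_matrix_def hermitian_adjacency_matrix_def
    hermitian_entry_def
  by auto

lemma ordered_eigenvalues_eigenvalue_iff:
  assumes M: "M \<in> carrier_mat n n" and ord: "ordered_eigenvalues M ev"
  shows "eigenvalue M k \<longleftrightarrow> (\<exists>i\<in>{1..n}. k = complex_of_real (ev i))"
  using M ord
  by (auto simp: eigenvalue_root_char_poly[OF M] ordered_eigenvalues_def poly_prod)

theorem theorem3p2:
  fixes V :: "'a set" and E :: "'a set set" and A :: "('a \<times> 'a) set"
    and vs :: "'a list" and n :: nat
    and \<alpha> a b :: real and \<beta> :: complex and ev :: "nat \<Rightarrow> real"
  assumes "mixed_graph V E A"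
    and "distinct vs" and "set vs = V" and "length vs = n" and "n \<ge> 1"
    and "0 \<le> \<alpha>" and "\<alpha> \<le> 1"
    and "\<beta> = Complex a b" and "cmod \<beta> = 1" and "a \<ge> 0"
    and "ordered_eigenvalues (A_alpha_beta vs E A \<alpha> \<beta>) ev"
  shows "1 / 3 * spectral_radius (A_alpha_beta vs E A \<alpha> \<beta>) \<le> ev 1
    \<and> ev 1 \<le> spectral_radius (A_alpha_beta vs E A \<alpha> \<beta>)"
proof -
  define M where "M = A_alpha_beta vs E A \<alpha> \<beta>"
  have M: "M \<in> carrier_mat n n"
    using A_alpha_beta_carrier assms(4) by (auto simp: M_def)
  have herm: "hermitian_mat M"
    using A_alpha_beta_hermitian assms(1) by (auto simp: M_def)
  have Re_nonneg: "Re (M $$ (i, j)) \<ge> 0" if "i < n" "j < n" for i j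
    using that assms by (auto simp: M_def intro!: A_alpha_beta_Re_nonneg)
  have n: "n > 0" using assms(5) by simp
  have ord: "ordered_eigenvalues M ev" using assms(11) by (simp add: M_def)
  note ev_iff = ordered_eigenvalues_eigenvalue_iff[OF M ord]
  have le_ev1: "ev i \<le> ev 1" if "i \<in> {1..n}" for i
    using ord M that n monotone_onD[of "{1..n}" "(\<le>)" "(\<ge>)" ev 1 i]
    by (auto simp: ordered_eigenvalues_def)
  obtain \<mu> where \<mu>: "eigenvalue M (complex_of_real \<mu>)"
    "\<And>x. x \<in> carrier_vec n \<Longrightarrow> quad_form M x \<le> \<mu> * norm_sq x"
    using rayleigh_bound_attained_by_eigenvalue[OF herm M n] by blast
  have \<mu>_le: "\<mu> \<le> ev 1"
    using \<mu>(1) le_ev1 by (auto simp: ev_iff)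
  \<comment> \<open>Applied to \<open>ev 1\<close> itself, the lower bound shows \<open>ev 1 \<ge> 0\<close>; this settles the positive eigenvalues.\<close>
  have abs_le: "\<bar>ev i\<bar> \<le> 3 * ev 1" if i: "i \<in> {1..n}" for i
  proof -
    have "eigenvalue M (complex_of_real (ev i))" using i by (auto simp: ev_iff)
    then have "- ev i \<le> 3 * \<mu>"
      using eigenvalue_ge_minus_three_times_bound[OF M Re_nonneg \<mu>(2)] by blast
    moreover have "eigenvalue M (complex_of_real (ev 1))" using n by (auto simp: ev_iff)
    then have "- ev 1 \<le> 3 * \<mu>"
      using eigenvalue_ge_minus_three_times_bound[OF M Re_nonneg \<mu>(2)] by blast
    ultimately show ?thesis using \<mu>_le le_ev1[OF i] by linarith
  qed
  have "spectral_radius M \<le> 3 * ev 1"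
    using spectral_radius_mem_max(1)[OF M n] abs_le
    by (auto simp: spectrum_def ev_iff)
  moreover have "ev 1 \<le> spectral_radius M"
  proof -
    have "complex_of_real (ev 1) \<in> spectrum M"
      using assms(5) by (auto simp: spectrum_def ev_iff)
    then have "\<bar>ev 1\<bar> \<le> spectral_radius M"
      by (metis spectral_radius_mem_max(2)[OF M n] imageI norm_of_real)
    then show ?thesis by linarith
  qed
  ultimately show ?thesis by (simp add: M_def)
qed

end
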